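(* For every integer $m\ge 2$, let $a_m=\lfloor(\sqrt{2m-1}-1)/2\rfloor$ and $b_m=\lfloor\sqrt{m/2}\rfloor$. Then the almost-squares $n$ with $(m-1)^2<n\le m(m-1)$ are exactly the numbers $$(m+a_m)(m-a_m-1),\ (m+a_m-1)(m-a_m),\ \dots,\ (m+1)(m-2),\ m(m-1),$$ i.e. the numbers $(m+a)(m-a-1)$ with $a$ an integer, $0\le a\le a_m$; and the almost-squares $n$ with $m(m-1)<n\le m^2$ are exactly the numbers $$(m+b_m)(m-b_m),\ (m+b_m-1)(m-b_m+1),\ \dots,\ (m+1)(m-1),\ m^2,$$ i.e. the numbers $m^2-b^2$ with $b$ an integer, $0\le b\le b_m$. In particular, the almost-squares between $(m-1)^2+1$ and $m^2$ inclusive are exactly the numbers in these two lists.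
   Context: For a positive integer $n$, let $s(n)=\min_{d\mid n}(d+n/d)$ (the least semiperimeter of a rectangle with positive integer side lengths and area $n$), and let $F(n)=n/s(n)$. A positive integer $n$ is called an almost-square if $F(k)\le F(n)$ for all positive integers $k\le n$. $\lfloor x\rfloor$ denotes the greatest integer not exceeding $x$. *)

theory Defs
  imports Complex_Main
begin

text \<open>Positive integers are rendered as elements of \<^typ>\<open>int\<close> with explicit positivity guards, so
  that subtraction is never truncated. The values of the functions below are only
  meaningful for positive arguments.\<close>

definition min_semiperimeter :: "int \<Rightarrow> int" where
  "min_semiperimeter n = Min {d + n div d | d. 0 < d \<and> d dvd n}"

definition area_ratio :: "int \<Rightarrow> real" where
  "area_ratio n = real_of_int n / real_of_int (min_semiperimeter n)"

definition almost_square :: "int \<Rightarrow> bool" where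
  "almost_square n \<longleftrightarrow> 0 < n \<and> (\<forall>k. 0 < k \<and> k \<le> n \<longrightarrow> area_ratio k \<le> area_ratio n)"

definition a_bound :: "int \<Rightarrow> int" where
  "a_bound m = \<lfloor>(sqrt (2 * real_of_int m - 1) - 1) / 2\<rfloor>"

definition b_bound :: "int \<Rightarrow> int" where
  "b_bound m = \<lfloor>sqrt (real_of_int m / 2)\<rfloor>"

end

theory Submission
  imports Defs
begin

text \<open>Write \<open>s\<close> for the least semiperimeter. If \<open>n = x y\<close> then \<open>(x + y)\<^sup>2 = 4 n + (x - y)\<^sup>2\<close>, so
  \<open>s n \<ge> 2 m - 1\<close> for \<open>n > (m - 1)\<^sup>2\<close> and \<open>s n \<ge> 2 m\<close> for \<open>n > m (m - 1)\<close>. Equality holds in the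
  first range exactly for \<open>n = m (m - 1) - a (a + 1)\<close> and in the second exactly for
  \<open>n = m\<^sup>2 - b\<^sup>2\<close>. An almost-square must reach these least values, because it has to compete
  with the last number of the preceding range, \<open>(m - 1)\<^sup>2\<close> or \<open>m (m - 1)\<close>. Conversely, if \<open>s n\<close> is
  least, then \<open>n\<close> beats all smaller numbers of its own range, and comparison with
  the last number of the preceding range gives \<open>2 a (a + 1) \<le> m - 1\<close> and \<open>2 b\<^sup>2 \<le> m\<close>.\<close>

section \<open>Basic properties of the least semiperimeter\<close>

lemma finite_semiperimeters:
  fixes n :: int
  assumes "0 < n"
  shows "finite {d + n div d | d. 0 < d \<and> d dvd n}"
proof -
  have "{d + n div d | d. 0 < d \<and> d dvd n} \<subseteq> (\<lambda>d. d + n div d) ` {0..n}"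
    using assms zdvd_imp_le by fastforce
  then show ?thesis
    by (rule finite_subset) simp
qed

lemma min_semiperimeter_le:
  assumes "0 < x" "0 < y"
  shows "min_semiperimeter (x * y) \<le> x + y"
  unfolding min_semiperimeter_def
proof (rule Min_le)
  show "finite {d + x * y div d | d. 0 < d \<and> d dvd x * y}"
    using assms by (simp add: finite_semiperimeters)
  show "x + y \<in> {d + x * y div d | d. 0 < d \<and> d dvd x * y}"
    using assms by (intro CollectI exI[of _ x]) simp
qed

lemma min_semiperimeter_attained:
  assumes "0 < n"
  obtains x y where "0 < x" "0 < y" "n = x * y" "min_semiperimeter n = x + y"
proof -
  \<comment> \<open>The divisor 1 shows that the set is nonempty, so that its \<open>Min\<close> is
    a member.\<close>
  have "1 + n div 1 \<in> {d + n div d | d. 0 < d \<and> d dvd n}"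
    by (rule CollectI, rule exI[of _ 1]) simp
  then have "min_semiperimeter n \<in> {d + n div d | d. 0 < d \<and> d dvd n}"
    unfolding min_semiperimeter_def
    using Min_in[OF finite_semiperimeters[OF assms]] by blast
  then obtain d where d: "0 < d" "d dvd n" "min_semiperimeter n = d + n div d"
    by blast
  then have "n = d * (n div d)"
    by simp
  moreover from this have "0 < n div d"
    using d assms zero_less_mult_pos by metis
  ultimately show thesis
    using d that by blast
qed

lemma min_semiperimeter_pos:
  assumes "0 < n"
  shows "0 < min_semiperimeter n"
  using min_semiperimeter_attained[OF assms] by (metis add_pos_pos)

lemma four_mult_le_min_semiperimeter_sq:
  assumes "0 < n"
  shows "4 * n \<le> (min_semiperimeter n)\<^sup>2"
proof -
  obtain x y where "n = x * y" "min_semiperimeter n = x + y"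
    using min_semiperimeter_attained[OF assms] by metis
  moreover have "(x + y)\<^sup>2 = 4 * (x * y) + (x - y)\<^sup>2"
    by (simp add: power2_eq_square algebra_simps)
  ultimately show ?thesis
    by simp
qed

section \<open>Least semiperimeter in the two ranges\<close>

lemma min_semiperimeter_ge_odd:
  assumes "1 \<le> m" "(m - 1)\<^sup>2 < n"
  shows "2 * m - 1 \<le> min_semiperimeter n"
proof -
  have "0 < n"
    using assms(2) by (smt (verit) zero_le_power2)
  have "(2 * (m - 1))\<^sup>2 = 4 * (m - 1)\<^sup>2"
    by (simp only: power_mult_distrib) simp
  then have "(2 * (m - 1))\<^sup>2 < (min_semiperimeter n)\<^sup>2"
    using four_mult_le_min_semiperimeter_sq[OF \<open>0 < n\<close>] assms by linarith
  then have "2 * (m - 1) < min_semiperimeter n"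
    using min_semiperimeter_pos[OF \<open>0 < n\<close>] by (simp add: power2_less_imp_less)
  then show ?thesis
    by simp
qed

text \<open>The odd square (2m-1)^2 exceeds 4m(m-1) by only 1, whereas 4n exceeds it by at least
  4.\<close>

lemma min_semiperimeter_ge_even:
  assumes "1 \<le> m" "m * (m - 1) < n"
  shows "2 * m \<le> min_semiperimeter n"
proof -
  have "0 \<le> m * (m - 1)"
    using assms by simp
  then have "0 < n"
    using assms by linarith
  have "(2 * m - 1)\<^sup>2 = 4 * (m * (m - 1)) + 1"
    by (simp add: power2_eq_square algebra_simps)
  then have "(2 * m - 1)\<^sup>2 < (min_semiperimeter n)\<^sup>2"
    using four_mult_le_min_semiperimeter_sq[OF \<open>0 < n\<close>] assms by linarith
  then have "2 * m - 1 < min_semiperimeter n"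
    using min_semiperimeter_pos[OF \<open>0 < n\<close>] by (simp add: power2_less_imp_less)
  then show ?thesis
    by simp
qed

text \<open>Two integers with sum 2m-1 cannot both be below m; the one that is at least m is named
  m+a, which makes the other m-a-1. Conversely, n > 0 forces m-a-1 > 0, so the factorization is a
  genuine rectangle and the lower bound is attained.\<close>

lemma min_semiperimeter_odd_iff:
  assumes "1 \<le> m" "(m - 1)\<^sup>2 < n"
  shows "min_semiperimeter n = 2 * m - 1 \<longleftrightarrow> (\<exists>a\<ge>0. n = (m + a) * (m - a - 1))"
proof
  assume s: "min_semiperimeter n = 2 * m - 1"
  have "0 < n"
    using assms(2) by (smt (verit) zero_le_power2)
  then obtain x y where xy: "n = x * y" "x + y = 2 * m - 1"
    using min_semiperimeter_attained s by metis
  then have x: "x = 2 * m - 1 - y" and y: "y = 2 * m - 1 - x"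
    by simp_all
  show "\<exists>a\<ge>0. n = (m + a) * (m - a - 1)"
  proof (cases "m \<le> x")
    case True
    then show ?thesis
      unfolding xy(1) by (intro exI[of _ "x - m"]) (subst y, simp add: algebra_simps)
  next
    case False
    then show ?thesis
      unfolding xy(1) using xy(2)
      by (intro exI[of _ "y - m"] conjI, simp) (subst x, simp add: algebra_simps)
  qed
next
  assume "\<exists>a\<ge>0. n = (m + a) * (m - a - 1)"
  then obtain a where a: "0 \<le> a" "n = (m + a) * (m - a - 1)"
    by blast
  have "0 < n"
    using assms(2) by (smt (verit) zero_le_power2)
  moreover have "0 < m + a"
    using a assms by simp
  ultimately have "0 < m - a - 1"
    using a zero_less_mult_pos by metis
  then have "min_semiperimeter n \<le> 2 * m - 1"
    using min_semiperimeter_le[OF \<open>0 < m + a\<close>] a by fastforce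
  then show "min_semiperimeter n = 2 * m - 1"
    using min_semiperimeter_ge_odd[OF assms] by simp
qed

lemma min_semiperimeter_even_iff:
  assumes "1 \<le> m" "m * (m - 1) < n"
  shows "min_semiperimeter n = 2 * m \<longleftrightarrow> (\<exists>b\<ge>0. n = m\<^sup>2 - b\<^sup>2)"
proof -
  have "0 \<le> m * (m - 1)"
    using assms by simp
  then have "0 < n"
    using assms by linarith
  show ?thesis
  proof
    assume "min_semiperimeter n = 2 * m"
    then obtain x y where xy: "n = x * y" "x + y = 2 * m"
      using min_semiperimeter_attained \<open>0 < n\<close> by metis
    then have y: "y = 2 * m - x"
      by simp
    \<comment> \<open>The factors have mean m, so b is the distance of either one from m.\<close>
    have "n = m\<^sup>2 - \<bar>x - m\<bar>\<^sup>2"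
      unfolding xy(1) y by (simp add: power2_eq_square algebra_simps)
    then show "\<exists>b\<ge>0. n = m\<^sup>2 - b\<^sup>2"
      by (metis abs_ge_zero)
  next
    assume "\<exists>b\<ge>0. n = m\<^sup>2 - b\<^sup>2"
    then obtain b where b: "0 \<le> b" "n = (m + b) * (m - b)"
      by (auto simp: power2_eq_square algebra_simps)
    have "0 < m + b"
      using b assms by simp
    then have "0 < m - b"
      using b \<open>0 < n\<close> zero_less_mult_pos by metis
    then have "min_semiperimeter n \<le> 2 * m"
      using min_semiperimeter_le[OF \<open>0 < m + b\<close>] b by fastforce
    then show "min_semiperimeter n = 2 * m"
      using min_semiperimeter_ge_even[OF assms] by simp
  qed
qed

section \<open>Criteria for almost-squares in the two ranges\<close>

lemma area_ratio_le_iff: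
  assumes "0 < k" "0 < n"
  shows "area_ratio k \<le> area_ratio n \<longleftrightarrow> k * min_semiperimeter n \<le> n * min_semiperimeter k"
proof -
  have "area_ratio k \<le> area_ratio n \<longleftrightarrow>
      real_of_int (k * min_semiperimeter n) \<le> real_of_int (n * min_semiperimeter k)"
    using min_semiperimeter_pos[OF assms(1)] min_semiperimeter_pos[OF assms(2)]
    by (simp add: area_ratio_def field_simps)
  then show ?thesis
    by linarith
qed

lemma almost_square_iff:
  assumes "0 < n"
  shows "almost_square n \<longleftrightarrow>
    (\<forall>k. 0 < k \<and> k \<le> n \<longrightarrow> k * min_semiperimeter n \<le> n * min_semiperimeter k)"
  using assms by (auto simp: almost_square_def area_ratio_le_iff)

text \<open>Multiply k \<le> r^2 by 4k \<le> s(k)^2 and take roots. In terms of F this reads F(k)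
  \<le> r/2; with r = m-1 it disposes of all k up to (m-1)^2 at once.\<close>

lemma two_mult_le_min_semiperimeter_mult:
  assumes "0 < k" "0 \<le> r" "k \<le> r\<^sup>2"
  shows "2 * k \<le> r * min_semiperimeter k"
proof (rule power2_le_imp_le)
  have "(2 * k)\<^sup>2 = k * (4 * k)"
    by (simp add: power2_eq_square)
  also have "\<dots> \<le> r\<^sup>2 * (min_semiperimeter k)\<^sup>2"
    using assms four_mult_le_min_semiperimeter_sq by (intro mult_mono) auto
  finally show "(2 * k)\<^sup>2 \<le> (r * min_semiperimeter k)\<^sup>2"
    by (simp add: power_mult_distrib)
  show "0 \<le> r * min_semiperimeter k"
    using assms min_semiperimeter_pos[of k] by simp
qed

text \<open>Once s(n) = 2m-1, the inequality says F(n) \<ge> (m-1)/2, the value of F at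
  (m-1)^2.\<close>

lemma almost_square_odd_iff:
  assumes "2 \<le> m" "(m - 1)\<^sup>2 < n" "n \<le> m * (m - 1)"
  shows "almost_square n \<longleftrightarrow>
    min_semiperimeter n = 2 * m - 1 \<and> (m - 1) * (2 * m - 1) \<le> 2 * n"
proof -
  have "0 < n"
    using assms(2) by (smt (verit) zero_le_power2)
  define s where "s = min_semiperimeter n"
  have s_ge: "2 * m - 1 \<le> s"
    using assms min_semiperimeter_ge_odd by (simp add: s_def)
  show ?thesis
    unfolding almost_square_iff[OF \<open>0 < n\<close>] s_def[symmetric]
  proof (intro iffI conjI allI impI)
    assume *: "\<forall>k. 0 < k \<and> k \<le> n \<longrightarrow> k * s \<le> n * min_semiperimeter k"
    have "min_semiperimeter ((m - 1)\<^sup>2) \<le> 2 * (m - 1)"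
      using min_semiperimeter_le[of "m - 1" "m - 1"] assms by (simp add: power2_eq_square)
    then have "n * min_semiperimeter ((m - 1)\<^sup>2) \<le> n * (2 * (m - 1))"
      using \<open>0 < n\<close> by simp
    then have "(m - 1)\<^sup>2 * s \<le> n * (2 * (m - 1))"
      using *[rule_format, of "(m - 1)\<^sup>2"] assms by simp
    then have "(m - 1) * ((m - 1) * s) \<le> (m - 1) * (2 * n)"
      by (simp add: power2_eq_square algebra_simps)
    then have ns: "(m - 1) * s \<le> 2 * n"
      using assms by simp
    show "s = 2 * m - 1"
    \<comment> \<open>If s \<ge> 2m, then \<open>ns\<close> pushes n up to the end m(m-1) of the
      range. But that number has the form with a = 0, so its least semiperimeter is 2m-1.\<close>
    proof (rule ccontr)
      assume ne: "s \<noteq> 2 * m - 1"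
      then have "(m - 1) * (2 * m) \<le> (m - 1) * s"
        using s_ge assms by (intro mult_left_mono) auto
      then have "n = m * (m - 1)"
        using ns assms by (simp add: algebra_simps)
      then have "n = (m + 0) * (m - 0 - 1)"
        by simp
      then show False
        using ne min_semiperimeter_odd_iff[of m n] assms s_def by auto
    qed
    then show "(m - 1) * (2 * m - 1) \<le> 2 * n"
      using ns by simp
  next
    fix k
    assume *: "s = 2 * m - 1 \<and> (m - 1) * (2 * m - 1) \<le> 2 * n" and k: "0 < k \<and> k \<le> n"
    have t: "0 < min_semiperimeter k"
      using k min_semiperimeter_pos by simp
    show "k * s \<le> n * min_semiperimeter k"
    proof (cases "k \<le> (m - 1)\<^sup>2")
      case True
      then have "2 * k * s \<le> (m - 1) * min_semiperimeter k * s"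
        using k assms s_ge two_mult_le_min_semiperimeter_mult[of k "m - 1"]
        by (intro mult_right_mono) auto
      also have "\<dots> = ((m - 1) * (2 * m - 1)) * min_semiperimeter k"
        using * by simp
      also have "\<dots> \<le> 2 * n * min_semiperimeter k"
        using * t by (intro mult_right_mono) auto
      finally show ?thesis
        by simp
    next
      case False
      \<comment> \<open>Here k lies in the same range as n, where s is the least possible
        value.\<close>
      then have "s \<le> min_semiperimeter k"
        using * min_semiperimeter_ge_odd[of m k] assms by simp
      then show ?thesis
        using k s_ge assms by (intro mult_mono) auto
    qed
  qed
qed

text \<open>Once s(n) = 2m, the inequality says F(n) \<ge> m(m-1)/(2m-1), the value of F at
  m(m-1).\<close>

lemma almost_square_even_iff:
  assumes "2 \<le> m" "m * (m - 1) < n" "n \<le> m\<^sup>2"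
  shows "almost_square n \<longleftrightarrow>
    min_semiperimeter n = 2 * m \<and> 2 * m\<^sup>2 * (m - 1) \<le> n * (2 * m - 1)"
proof -
  have pos: "0 < m * (m - 1)"
    using assms by simp
  then have "0 < n"
    using assms by linarith
  define s where "s = min_semiperimeter n"
  have s_ge: "2 * m \<le> s"
    using assms min_semiperimeter_ge_even by (simp add: s_def)
  show ?thesis
    unfolding almost_square_iff[OF \<open>0 < n\<close>] s_def[symmetric]
  proof (intro iffI conjI allI impI)
    assume *: "\<forall>k. 0 < k \<and> k \<le> n \<longrightarrow> k * s \<le> n * min_semiperimeter k"
    have "min_semiperimeter (m * (m - 1)) \<le> 2 * m - 1"
      using min_semiperimeter_le[of m "m - 1"] assms by simp
    then have "n * min_semiperimeter (m * (m - 1)) \<le> n * (2 * m - 1)"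
      using \<open>0 < n\<close> by simp
    then have ns: "m * (m - 1) * s \<le> n * (2 * m - 1)"
      using *[rule_format, of "m * (m - 1)"] assms pos by linarith
    show "s = 2 * m"
    proof (rule ccontr)
      assume ne: "s \<noteq> 2 * m"
      then have "m * (m - 1) * (2 * m + 1) \<le> m * (m - 1) * s"
        using s_ge pos by (intro mult_left_mono) auto
      \<comment> \<open>This uses m(m-1)(2m+1) = m^2(2m-1) - m. Since m < 2m-1, only n = m^2
        survives, and there b = 0 gives s = 2m.\<close>
      then have "(m\<^sup>2 - n) * (2 * m - 1) \<le> m"
        using ns by (simp add: power2_eq_square algebra_simps)
      also have "m < 1 * (2 * m - 1)"
        using assms by simp
      finally have "m\<^sup>2 - n < 1"
        using assms by (simp only: mult_less_cancel_right_pos)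
      then have "n = m\<^sup>2 - 0\<^sup>2"
        using assms by simp
      then show False
        using ne min_semiperimeter_even_iff[of m n] assms s_def by auto
    qed
    then show "2 * m\<^sup>2 * (m - 1) \<le> n * (2 * m - 1)"
      using ns by (simp add: power2_eq_square algebra_simps)
  next
    fix k
    assume *: "s = 2 * m \<and> 2 * m\<^sup>2 * (m - 1) \<le> n * (2 * m - 1)" and k: "0 < k \<and> k \<le> n"
    have t: "0 < min_semiperimeter k"
      using k min_semiperimeter_pos by simp
    \<comment> \<open>In the first case F(k) \<le> (m-1)/2 < n/(2m); in the second F(k) \<le>
      m(m-1)/(2m-1), which is where the assumed inequality enters; in the third s is already
      least.\<close>
    consider "k \<le> (m - 1)\<^sup>2" | "(m - 1)\<^sup>2 < k" "k \<le> m * (m - 1)" | "m * (m - 1) < k"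
      by linarith
    then show "k * s \<le> n * min_semiperimeter k"
    proof cases
      case 1
      have "k * s = m * (2 * k)"
        using * by simp
      also have "\<dots> \<le> m * ((m - 1) * min_semiperimeter k)"
        using 1 k assms two_mult_le_min_semiperimeter_mult[of k "m - 1"]
        by (intro mult_left_mono) auto
      also have "\<dots> = m * (m - 1) * min_semiperimeter k"
        by simp
      also have "\<dots> \<le> n * min_semiperimeter k"
        using t assms by (intro mult_right_mono) auto
      finally show ?thesis .
    next
      case 2
      have "k * s \<le> m * (m - 1) * s"
        using 2 s_ge assms by (intro mult_right_mono) auto
      also have "\<dots> \<le> n * (2 * m - 1)"
        using * by (simp add: power2_eq_square algebra_simps)
      also have "\<dots> \<le> n * min_semiperimeter k"
        using \<open>0 < n\<close> min_semiperimeter_ge_odd[of m k] 2 assms by simp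
      finally show ?thesis .
    next
      case 3
      then have "s \<le> min_semiperimeter k"
        using * min_semiperimeter_ge_even[of m k] assms by simp
      then show ?thesis
        using k s_ge assms by (intro mult_mono) auto
    qed
  qed
qed

section \<open>The floor bounds as integer inequalities\<close>

lemma le_sqrt_iff:
  fixes x y :: real
  assumes "0 \<le> x"
  shows "x \<le> sqrt y \<longleftrightarrow> x\<^sup>2 \<le> y"
  using assms real_le_rsqrt sqrt_ge_absD[of x y] by auto

text \<open>The floor unfolds to 2a+1 \<le> sqrt(2m-1); both sides may be squared because a \<ge> 0,
  and (2a+1)^2 = 4a(a+1) + 1.\<close>

lemma le_a_bound_iff:
  assumes "0 \<le> a"
  shows "a \<le> a_bound m \<longleftrightarrow> 2 * (a * (a + 1)) \<le> m - 1"
proof -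
  have "a \<le> a_bound m \<longleftrightarrow> 2 * real_of_int a + 1 \<le> sqrt (2 * real_of_int m - 1)"
    by (auto simp: a_bound_def le_floor_iff)
  also have "\<dots> \<longleftrightarrow> (2 * real_of_int a + 1)\<^sup>2 \<le> 2 * real_of_int m - 1"
    using assms by (simp add: le_sqrt_iff)
  also have "\<dots> \<longleftrightarrow> real_of_int ((2 * a + 1)\<^sup>2) \<le> real_of_int (2 * m - 1)"
    by simp
  also have "\<dots> \<longleftrightarrow> (2 * a + 1)\<^sup>2 \<le> 2 * m - 1"
    by linarith
  also have "\<dots> \<longleftrightarrow> 2 * (a * (a + 1)) \<le> m - 1"
    by (auto simp: power2_eq_square algebra_simps)
  finally show ?thesis .
qed

lemma le_b_bound_iff:
  assumes "0 \<le> b"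
  shows "b \<le> b_bound m \<longleftrightarrow> 2 * b\<^sup>2 \<le> m"
proof -
  have "b \<le> b_bound m \<longleftrightarrow> real_of_int b \<le> sqrt (real_of_int m / 2)"
    by (simp add: b_bound_def le_floor_iff)
  also have "\<dots> \<longleftrightarrow> (real_of_int b)\<^sup>2 \<le> real_of_int m / 2"
    using assms by (simp add: le_sqrt_iff)
  also have "\<dots> \<longleftrightarrow> real_of_int (2 * b\<^sup>2) \<le> real_of_int m"
    by auto
  also have "\<dots> \<longleftrightarrow> 2 * b\<^sup>2 \<le> m"
    by linarith
  finally show ?thesis .
qed

section \<open>The lists of almost-squares\<close>

lemma almost_squares_odd:
  assumes "2 \<le> m"
  shows "{n. almost_square n \<and> (m - 1)\<^sup>2 < n \<and> n \<le> m * (m - 1)}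
    = {(m + a) * (m - a - 1) | a. 0 \<le> a \<and> a \<le> a_bound m}" (is "?L = ?R")
proof -
  have prod: "(m + a) * (m - a - 1) = m * (m - 1) - a * (a + 1)" for a
    by (simp add: algebra_simps)
  have sq: "(m - 1)\<^sup>2 = m * (m - 1) - (m - 1)"
    by (simp add: power2_eq_square algebra_simps)
  \<comment> \<open>Twice the product is 2m(m-1) - 2a(a+1), and 2m(m-1) exceeds (m-1)(2m-1) by
    m-1.\<close>
  have cond: "(m - 1) * (2 * m - 1) \<le> 2 * ((m + a) * (m - a - 1)) \<longleftrightarrow> a \<le> a_bound m"
    if "0 \<le> a" for a
    unfolding le_a_bound_iff[OF that] prod by (auto simp: algebra_simps)
  show ?thesis
  proof (intro equalityI subsetI)
    fix n
    assume "n \<in> ?L"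
    then have n: "almost_square n" "(m - 1)\<^sup>2 < n" "n \<le> m * (m - 1)"
      by auto
    have "min_semiperimeter n = 2 * m - 1" and *: "(m - 1) * (2 * m - 1) \<le> 2 * n"
      using n almost_square_odd_iff[OF assms n(2,3)] by auto
    then obtain a where "0 \<le> a" "n = (m + a) * (m - a - 1)"
      using min_semiperimeter_odd_iff[of m n] n assms by auto
    then show "n \<in> ?R"
      using * cond by auto
  next
    fix n
    assume "n \<in> ?R"
    then obtain a where a: "0 \<le> a" "a \<le> a_bound m" "n = (m + a) * (m - a - 1)"
      by auto
    \<comment> \<open>Since m \<ge> 2, this gives a(a+1) < m-1, which keeps n strictly above
      (m-1)^2.\<close>
    have "0 \<le> a * (a + 1)" "2 * (a * (a + 1)) \<le> m - 1"
      using a le_a_bound_iff[of a m] by auto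
    then have n: "(m - 1)\<^sup>2 < n" "n \<le> m * (m - 1)"
      using assms unfolding a(3) prod sq by linarith+
    then have "min_semiperimeter n = 2 * m - 1"
      using min_semiperimeter_odd_iff[of m n] a assms by auto
    then show "n \<in> ?L"
      using almost_square_odd_iff[OF assms n] cond[OF a(1)] a n by auto
  qed
qed

lemma almost_squares_even:
  assumes "2 \<le> m"
  shows "{n. almost_square n \<and> m * (m - 1) < n \<and> n \<le> m\<^sup>2}
    = {m\<^sup>2 - b\<^sup>2 | b. 0 \<le> b \<and> b \<le> b_bound m}" (is "?L = ?R")
proof -
  have cond: "2 * m\<^sup>2 * (m - 1) \<le> (m\<^sup>2 - b\<^sup>2) * (2 * m - 1) \<longleftrightarrow> b \<le> b_bound m"
    if "0 \<le> b" for b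
  proof -
    have "2 * m\<^sup>2 * (m - 1) \<le> (m\<^sup>2 - b\<^sup>2) * (2 * m - 1) \<longleftrightarrow> b\<^sup>2 * (2 * m - 1) \<le> m\<^sup>2"
      by (auto simp: power2_eq_square algebra_simps)
    \<comment> \<open>The bound m^2/(2m-1) is slightly larger than m/2, but integrality closes the
      gap: 2b^2 \<ge> m+1 would give (m+1)(2m-1) \<le> 2m^2, that is, m \<le> 1.\<close>
    also have "\<dots> \<longleftrightarrow> 2 * b\<^sup>2 \<le> m"
    proof
      assume *: "b\<^sup>2 * (2 * m - 1) \<le> m\<^sup>2"
      show "2 * b\<^sup>2 \<le> m"
      proof (rule ccontr)
        assume "\<not> 2 * b\<^sup>2 \<le> m"
        then have "(m + 1) * (2 * m - 1) \<le> (2 * b\<^sup>2) * (2 * m - 1)"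
          using assms by (intro mult_right_mono) auto
        then show False
          using * assms by (simp add: power2_eq_square algebra_simps)
      qed
    next
      assume "2 * b\<^sup>2 \<le> m"
      then have "2 * b\<^sup>2 * m \<le> m * m"
        using assms by (intro mult_right_mono) auto
      moreover have "b\<^sup>2 * (2 * m - 1) = 2 * b\<^sup>2 * m - b\<^sup>2"
        by (simp add: algebra_simps)
      ultimately show "b\<^sup>2 * (2 * m - 1) \<le> m\<^sup>2"
        using zero_le_power2[of b] unfolding power2_eq_square[of m] by linarith
    qed
    finally show ?thesis
      using le_b_bound_iff[OF that] by simp
  qed
  show ?thesis
  proof (intro equalityI subsetI)
    fix n
    assume "n \<in> ?L"
    then have n: "almost_square n" "m * (m - 1) < n" "n \<le> m\<^sup>2"
      by auto
    have "min_semiperimeter n = 2 * m" and *: "2 * m\<^sup>2 * (m - 1) \<le> n * (2 * m - 1)"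
      using n almost_square_even_iff[OF assms n(2,3)] by auto
    then obtain b where "0 \<le> b" "n = m\<^sup>2 - b\<^sup>2"
      using min_semiperimeter_even_iff[of m n] n assms by auto
    then show "n \<in> ?R"
      using * cond by auto
  next
    fix n
    assume "n \<in> ?R"
    then obtain b where b: "0 \<le> b" "b \<le> b_bound m" "n = m\<^sup>2 - b\<^sup>2"
      by auto
    have "2 * b\<^sup>2 \<le> m"
      using b le_b_bound_iff by auto
    moreover have "m * (m - 1) = m\<^sup>2 - m"
      by (simp add: power2_eq_square algebra_simps)
    ultimately have n: "m * (m - 1) < n" "n \<le> m\<^sup>2"
      using assms b zero_le_power2[of b] by linarith+
    then have "min_semiperimeter n = 2 * m"
      using min_semiperimeter_even_iff[of m n] b assms by auto
    then show "n \<in> ?L"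
      using almost_square_even_iff[OF assms n] cond[OF b(1)] b n by auto
  qed
qed

theorem mainTheorem1:
  fixes m :: int
  assumes "m \<ge> 2"
  shows "({n. almost_square n \<and> (m - 1)^2 < n \<and> n \<le> m * (m - 1)}
           = {(m + a) * (m - a - 1) | a. 0 \<le> a \<and> a \<le> a_bound m})
       \<and> ({n. almost_square n \<and> m * (m - 1) < n \<and> n \<le> m^2}
           = {m^2 - b^2 | b. 0 \<le> b \<and> b \<le> b_bound m})
       \<and> ({n. almost_square n \<and> (m - 1)^2 + 1 \<le> n \<and> n \<le> m^2}
           = {(m + a) * (m - a - 1) | a. 0 \<le> a \<and> a \<le> a_bound m}
             \<union> {m^2 - b^2 | b. 0 \<le> b \<and> b \<le> b_bound m})"
proof -
  have "(m - 1)\<^sup>2 = m * (m - 1) - (m - 1)" "m\<^sup>2 = m * (m - 1) + m"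
    by (simp_all add: power2_eq_square algebra_simps)
  then have "(m - 1)\<^sup>2 \<le> m * (m - 1)" "m * (m - 1) \<le> m\<^sup>2"
    using assms by linarith+
  \<comment> \<open>The two ranges are adjacent at m(m-1), and for integers the bound (m-1)^2 + 1
    \<le> n is the strict one.\<close>
  then have "{n. almost_square n \<and> (m - 1)\<^sup>2 + 1 \<le> n \<and> n \<le> m\<^sup>2}
    = {n. almost_square n \<and> (m - 1)\<^sup>2 < n \<and> n \<le> m * (m - 1)}
      \<union> {n. almost_square n \<and> m * (m - 1) < n \<and> n \<le> m\<^sup>2}"
    by auto
  then show ?thesis
    unfolding almost_squares_odd[OF assms] almost_squares_even[OF assms] by blast
qed

end
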